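(* Let $m \geq 1$ be an integer. Then $N_{m}(t, 2) = 2^{m-1}$ for $t \in \{0, 1\}$. If $t \in \mathbb{Z}_{4}$, then $$ N_{m}(t, 4) = \begin{cases} 2^{2m-2} + (-1)^{t/2}\, 2^{\frac{3m}{2} - 1} \cos \left(\frac{m \pi}{4} \right) & \text{if } t \equiv 0 \pmod 2, \\ 2^{2m-2} + (-1)^{(t-1)/2}\, 2^{\frac{3m}{2} - 1} \sin \left(\frac{m \pi}{4} \right) & \text{if } t \equiv 1 \pmod 2. \end{cases} $$
   Context: $\mathbb{Z}_n$ denotes the ring of integers modulo $n$. For $t \in \mathbb{Z}_n$, $N_m(t,n)$ is the number of ordered $m$-tuples $(x_1,\dots,x_m) \in \mathbb{Z}_n^m$ with $\sum_{i=1}^m x_i^2 \equiv t \pmod n$ (zero entries are allowed). In the exponents of $-1$, $t\in\mathbb{Z}_4$ is represented by an integer, e.g. in $\{0,1,2,3\}$; the value does not depend on the representative. *)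

theory Defs
  imports "HOL-Analysis.Analysis" "HOL-Number_Theory.Residues"
begin

(* The library's ring of integers modulo n, residue_ring n, has carrier {0..n - 1}; the m-tuples
   over it are the extensional functions on {1..m}. The target residue t is given by an
   arbitrary integer representative. *)
definition num_sum_squares :: "nat \<Rightarrow> int \<Rightarrow> nat \<Rightarrow> nat" where
  "num_sum_squares m t n =
     card {x \<in> {1..m} \<rightarrow>\<^sub>E carrier (residue_ring (int n)).
             [(\<Sum>i = 1..m. (x i)\<^sup>2) = t] (mod int n)}"

end

theory Submission
  imports Defs
begin

text \<open>
  Write \<open>N m t\<close> for the number of \<open>m\<close>-tuples whose squares sum to \<open>t\<close> for the modulus at hand.
  Splitting off the last coordinate of a tuple gives a recursion in \<open>m\<close>: a tuple with last entry
  \<open>a\<close> represents \<open>t\<close> exactly if the remaining entries represent \<open>t - a\<^sup>2\<close>.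

  Modulo 2 the two squares are 0 and 1, so \<open>N (m + 1) t = N m t + N m (t - 1)\<close>, and from
  \<open>N 1 t = 1\<close> on, the value doubles at each step, independently of \<open>t\<close>.
  Modulo 4 each of the squares 0 and 1 is attained twice,
  so \<open>N (m + 1) t = 2 * N m t + 2 * N m (t - 1)\<close>.

  The operator \<open>f t \<mapsto> 2 * f t + 2 * f (t - 1)\<close> on functions of period 4 is diagonalised by the
  additive characters \<open>t \<mapsto> \<i> ^ (j * t)\<close>. The eigenvalue of the trivial character is 4, that of
  \<open>(-1) ^ t\<close> is 0, and those of the remaining two are \<open>2 * (1 \<plusminus> \<i>) = 2 * sqrt 2 * cis (\<plusminus> pi / 4)\<close>.
  The initial value, the indicator of \<open>t = 0\<close>, is the mean of the four characters. Hence, for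
  \<open>m \<ge> 1\<close>, both parities of \<open>t\<close> are covered by the single formula
  \<open>N m t = 4 ^ (m - 1) + (2 * sqrt 2) ^ m / 2 * cos (m * pi / 4 - t * pi / 2)\<close>,
  which is the form suited to induction.
\<close>

lemma num_sum_squares_0:
  "num_sum_squares 0 t n = (if int n dvd t then 1 else 0)"
proof -
  have "[0 = t] (mod int n) \<longleftrightarrow> int n dvd t"
    by (simp add: cong_iff_dvd_diff)
  then show ?thesis
    by (simp add: num_sum_squares_def)
qed

lemma num_sum_squares_Suc:
  "num_sum_squares (Suc m) t n = (\<Sum>a = 0..int n - 1. num_sum_squares m (t - a\<^sup>2) n)"
proof -
  define C where "C = {0..int n - 1}"
  define S where "S = (\<lambda>(m :: nat) t. {x \<in> {1..m} \<rightarrow>\<^sub>E C. [(\<Sum>i = 1..m. (x i)\<^sup>2) = t] (mod int n)})"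
  have card_S: "num_sum_squares m t n = card (S m t)" for m t
    by (simp add: num_sum_squares_def S_def C_def residue_ring_def)
  have finite_S: "finite (S m t)" for m t
    by (rule finite_subset[OF _ finite_PiE[of "{1..m}" "\<lambda>_. C"]]) (auto simp: S_def C_def)
  let ?extend = "\<lambda>(a, x). x(Suc m := a)"
  have interval: "{1..Suc m} = insert (Suc m) {1..m}"
    by auto
  have sum_extend: "(\<Sum>i = 1..m. ((x(Suc m := a)) i)\<^sup>2) = (\<Sum>i = 1..m. (x i)\<^sup>2)"
    for a :: int and x
    by (intro sum.cong) auto
  have move_square: "[s + a\<^sup>2 = t] (mod int n) \<longleftrightarrow> [s = t - a\<^sup>2] (mod int n)" for s a :: int
    by (simp add: cong_iff_dvd_diff algebra_simps)
  have "inj_on ?extend (SIGMA a:C. S m (t - a\<^sup>2))"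
    by (rule inj_on_subset[OF inj_combinator[of "Suc m" "{1..m}" "\<lambda>_. C"]]) (auto simp: S_def)
  moreover have "?extend ` (SIGMA a:C. S m (t - a\<^sup>2)) = S (Suc m) t"
  proof -
    have "S (Suc m) t = {y \<in> ?extend ` (C \<times> ({1..m} \<rightarrow>\<^sub>E C)).
        [(\<Sum>i = 1..Suc m. (y i)\<^sup>2) = t] (mod int n)}"
      unfolding S_def interval PiE_insert_eq by simp
    also have "\<dots> = ?extend ` {(a, x) \<in> C \<times> ({1..m} \<rightarrow>\<^sub>E C).
        [(\<Sum>i = 1..m. (x i)\<^sup>2) = t - a\<^sup>2] (mod int n)}"
      by (auto simp: sum_extend move_square simp del: fun_upd_apply One_nat_def
          simp add: fun_upd_same intro!: rev_image_eqI)
    also have "{(a, x) \<in> C \<times> ({1..m} \<rightarrow>\<^sub>E C).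
        [(\<Sum>i = 1..m. (x i)\<^sup>2) = t - a\<^sup>2] (mod int n)} = (SIGMA a:C. S m (t - a\<^sup>2))"
      by (auto simp: S_def)
    finally show ?thesis by (rule sym)
  qed
  ultimately have "card (S (Suc m) t) = card (SIGMA a:C. S m (t - a\<^sup>2))"
    by (metis card_image)
  also have "\<dots> = (\<Sum>a\<in>C. card (S m (t - a\<^sup>2)))"
    by (rule card_SigmaI) (auto simp: finite_S C_def)
  finally show ?thesis
    by (simp add: card_S C_def)
qed

lemma num_sum_squares_cong:
  assumes "[s = t] (mod int n)"
  shows "num_sum_squares m s n = num_sum_squares m t n"
  using assms unfolding num_sum_squares_def by (metis cong_sym cong_trans)

lemma num_sum_squares_mod_2_Suc:
  "num_sum_squares (Suc m) t 2 = num_sum_squares m t 2 + num_sum_squares m (t - 1) 2"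
proof -
  have "{0..int 2 - 1} = {0, 1}" by auto
  then show ?thesis by (simp add: num_sum_squares_Suc)
qed

lemma num_sum_squares_mod_4_Suc:
  "num_sum_squares (Suc m) t 4 = 2 * num_sum_squares m t 4 + 2 * num_sum_squares m (t - 1) 4"
proof -
  have "{0..int 4 - 1} = {0, 1, 2, 3}" by auto
  moreover have "num_sum_squares m (t - 4) 4 = num_sum_squares m t 4"
    "num_sum_squares m (t - 9) 4 = num_sum_squares m (t - 1) 4"
    by (rule num_sum_squares_cong, simp add: cong_iff_dvd_diff)+
  ultimately show ?thesis by (simp add: num_sum_squares_Suc)
qed

lemma num_sum_squares_mod_2:
  assumes "m \<ge> 1"
  shows "num_sum_squares m t 2 = 2 ^ (m - 1)"
  using assms
proof (induction m arbitrary: t rule: nat_induct_at_least)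
  case base
  then show ?case
    using num_sum_squares_mod_2_Suc[of 0 t] by (simp add: num_sum_squares_0)
next
  case (Suc m)
  then show ?case
    by (simp add: num_sum_squares_mod_2_Suc mult_2[symmetric] power_eq_if[of _ m])
qed

lemma cos_minus_half_pi_multiple:
  fixes x :: real and s :: int
  shows "cos (x - real_of_int (2 * s) * pi / 2) = (-1) powi s * cos x"
    and "cos (x - real_of_int (2 * s + 1) * pi / 2) = (-1) powi s * sin x"
proof -
  have minus_multiple: "cos (y - real_of_int s * pi) = (-1) powi s * cos y" for y :: real
    by (simp add: cos_diff mult.commute[of _ pi] cos_npi_int sin_npi_int power_int_minus_left)
  from minus_multiple[of x]
  show "cos (x - real_of_int (2 * s) * pi / 2) = (-1) powi s * cos x"
    by simp
  have "x - real_of_int (2 * s + 1) * pi / 2 = (x - pi / 2) - real_of_int s * pi"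
    by (simp add: field_simps)
  then show "cos (x - real_of_int (2 * s + 1) * pi / 2) = (-1) powi s * sin x"
    by (simp only: minus_multiple) (simp add: cos_diff)
qed

text \<open>
  The induction starts at \<open>m = 1\<close>, since at \<open>m = 0\<close> the character \<open>(-1) ^ t\<close> still contributes. The
  step adds two cosines a quarter turn apart, which is the product with \<open>1 + \<i>\<close> in real terms:
  the amplitude grows by \<open>sqrt 2\<close> and the phase by \<open>pi / 4\<close>.
\<close>

lemma num_sum_squares_mod_4:
  assumes "m \<ge> 1"
  shows "real (num_sum_squares m t 4) =
    4 ^ (m - 1) + (2 * sqrt 2) ^ m / 2 * cos (real m * pi / 4 - real_of_int t * pi / 2)"
  using assms
proof (induction m arbitrary: t rule: nat_induct_at_least)
  case base
  have count: "num_sum_squares 1 t 4 = (if 4 dvd t then 2 else 0) + (if 4 dvd t - 1 then 2 else 0)"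
    using num_sum_squares_mod_4_Suc[of 0 t] by (simp add: num_sum_squares_0)
  obtain s where "t = 2 * s \<or> t = 2 * s + 1"
    by (metis evenE oddE)
  then show ?case
  proof
    assume t: "t = 2 * s"
    have "4 dvd t \<longleftrightarrow> even s" "\<not> 4 dvd t - 1"
      unfolding t by presburger+
    then show ?thesis
      unfolding count
      by (simp add: t cos_minus_half_pi_multiple(1)[simplified] cos_45 power_int_minus_left)
  next
    assume t: "t = 2 * s + 1"
    have "\<not> 4 dvd t" "4 dvd t - 1 \<longleftrightarrow> even s"
      unfolding t by presburger+
    then show ?thesis
      unfolding count
      by (simp add: t cos_minus_half_pi_multiple(2)[simplified] sin_45 power_int_minus_left)
  qed
next
  case (Suc m)
  let ?\<theta> = "real m * pi / 4 - real_of_int t * pi / 2"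
  have quarter_turn: "real m * pi / 4 - real_of_int (t - 1) * pi / 2 = ?\<theta> + pi / 2"
    by (simp add: field_simps)
  have eighth_turn: "real (Suc m) * pi / 4 - real_of_int t * pi / 2 = ?\<theta> + pi / 4"
    by (simp add: field_simps)
  have cosines: "2 * A * cos x + 2 * A * cos (x + pi / 2) = 2 * sqrt 2 * A * cos (x + pi / 4)"
    for A x :: real
  proof -
    have "cos x + cos (x + pi / 2) = sqrt 2 * cos (x + pi / 4)"
      by (simp add: cos_add cos_45 sin_45 algebra_simps)
    from arg_cong[OF this, of "\<lambda>y. 2 * A * y"] show ?thesis
      by (simp only: distrib_left mult_ac)
  qed
  have power_4: "4 ^ m = 4 * (4 ^ (m - 1) :: real)"
    using Suc.hyps by (cases m) simp_all
  have "real (num_sum_squares (Suc m) t 4) =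
      4 * 4 ^ (m - 1) +
      (2 * ((2 * sqrt 2) ^ m / 2) * cos ?\<theta> + 2 * ((2 * sqrt 2) ^ m / 2) * cos (?\<theta> + pi / 2))"
    unfolding num_sum_squares_mod_4_Suc of_nat_add of_nat_mult Suc.IH quarter_turn by simp
  also have "\<dots> = 4 ^ (Suc m - 1) + (2 * sqrt 2) ^ Suc m / 2 * cos (?\<theta> + pi / 4)"
    unfolding cosines by (simp add: power_4)
  finally show ?case
    unfolding eighth_turn .
qed

theorem theorem1p2:
  fixes m :: nat
  assumes "m \<ge> 1"
  shows "(\<forall>t \<in> {0, 1 :: int}. num_sum_squares m t 2 = 2 ^ (m - 1)) \<and>
    (\<forall>t :: int.
      ([t = 0] (mod 2) \<longrightarrow>
        real (num_sum_squares m t 4) =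
          2 ^ (2 * m - 2) + (-1) powi (t div 2) * 2 powr (3 * real m / 2 - 1) * cos (real m * pi / 4)) \<and>
      ([t = 1] (mod 2) \<longrightarrow>
        real (num_sum_squares m t 4) =
          2 ^ (2 * m - 2) + (-1) powi ((t - 1) div 2) * 2 powr (3 * real m / 2 - 1) * sin (real m * pi / 4)))"
proof -
  have main_term: "(4 :: real) ^ (m - 1) = 2 ^ (2 * m - 2)"
  proof -
    have "2 * m - 2 = 2 * (m - 1)" by simp
    then show ?thesis by (simp add: power_mult)
  qed
  have amplitude: "(2 * sqrt 2) ^ m / 2 = 2 powr (3 * real m / 2 - 1)"
  proof -
    have "2 * sqrt 2 = 2 powr (3 / 2)"
      using powr_add[of "2 :: real" 1 "1 / 2"] by (simp add: powr_half_sqrt)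
    then have "(2 * sqrt 2) ^ m = 2 powr (3 / 2 * real m)"
      by (simp add: powr_powr flip: powr_realpow)
    then show ?thesis
      by (simp add: powr_diff)
  qed
  note formula = num_sum_squares_mod_4[OF assms, unfolded main_term amplitude]
  have "real (num_sum_squares m t 4) =
      2 ^ (2 * m - 2) + (-1) powi (t div 2) * 2 powr (3 * real m / 2 - 1) * cos (real m * pi / 4)"
    if "[t = 0] (mod 2)" for t :: int
  proof -
    have "t = 2 * (t div 2)"
      using that unfolding cong_def by presburger
    from cos_minus_half_pi_multiple(1)[of "real m * pi / 4" "t div 2", folded this] show ?thesis
      by (simp add: formula)
  qed
  moreover have "real (num_sum_squares m t 4) =
      2 ^ (2 * m - 2) + (-1) powi ((t - 1) div 2) * 2 powr (3 * real m / 2 - 1) * sin (real m * pi / 4)"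
    if "[t = 1] (mod 2)" for t :: int
  proof -
    have "t = 2 * ((t - 1) div 2) + 1"
      using that unfolding cong_def by presburger
    from cos_minus_half_pi_multiple(2)[of "real m * pi / 4" "(t - 1) div 2", folded this]
    show ?thesis
      by (simp add: formula)
  qed
  ultimately show ?thesis
    using num_sum_squares_mod_2[OF assms] by blast
qed

end
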